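(* Let $\mathbb{E}$ be a Euclidean space and let $g:\mathbb{E}\to\mathbb{R}\cup\{+\infty\}$ be closed (lower semicontinuous), proper and convex. Then $g$ is $(-\mathrm{hzn}\,g)$-increasing, i.e. $g(x)\le g(y)$ for all $x,y\in\mathbb{E}$ with $y-x\in-\mathrm{hzn}\,g$.
   Context: A Euclidean space is a finite-dimensional real inner product space. For a closed, proper, convex $g$, the horizon cone $\mathrm{hzn}\,g$ is the recession cone $\{w : y+tw\in \mathrm{lev}_g(\alpha)\ \forall t\ge0,\ \forall y\in\mathrm{lev}_g(\alpha)\}$ of any nonempty sublevel set $\mathrm{lev}_g(\alpha)=\{y : g(y)\le\alpha\}$, $\alpha\in\mathbb{R}$ (it does not depend on the choice of $\alpha$). *)

theory Defs
  imports "HOL-Analysis.Analysis"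
begin

definition proper_fun :: "('a \<Rightarrow> ereal) \<Rightarrow> bool" where
  "proper_fun g \<longleftrightarrow> (\<forall>x. g x \<noteq> - \<infinity>) \<and> (\<exists>x. g x \<noteq> \<infinity>)"

definition lsc_fun :: "('a::topological_space \<Rightarrow> ereal) \<Rightarrow> bool" where
  "lsc_fun g \<longleftrightarrow> (\<forall>x. g x \<le> Liminf (at x) g)"

text \<open>Intended for functions that never take the value \<open>- \<infinity>\<close>, so that no sum
  \<open>\<infinity> - \<infinity>\<close> arises; at \<open>t = 0\<close> and \<open>t = 1\<close> the convention
  \<open>0 * \<infinity> = 0\<close> of \<^typ>\<open>ereal\<close> makes the inequality trivial.\<close>

definition convex_fun :: "('a::real_vector \<Rightarrow> ereal) \<Rightarrow> bool" where
  "convex_fun g \<longleftrightarrow>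
     (\<forall>x y. \<forall>t\<in>{0..1}. g ((1 - t) *\<^sub>R x + t *\<^sub>R y) \<le> ereal (1 - t) * g x + ereal t * g y)"

definition sublevel :: "('a \<Rightarrow> ereal) \<Rightarrow> real \<Rightarrow> 'a set" where
  "sublevel g \<alpha> = {y. g y \<le> ereal \<alpha>}"

definition recession_cone :: "'a::real_vector set \<Rightarrow> 'a set" where
  "recession_cone C = {w. \<forall>t\<ge>0. \<forall>y\<in>C. y + t *\<^sub>R w \<in> C}"

text \<open>The level is chosen arbitrarily among those with nonempty sublevel set; by
  \<open>hzn_eq_recession_cone\<close> below, the choice is immaterial for closed, proper,
  convex functions.\<close>

definition hzn :: "('a::real_vector \<Rightarrow> ereal) \<Rightarrow> 'a set" where
  "hzn g = recession_cone (sublevel g (SOME \<alpha>. sublevel g \<alpha> \<noteq> {}))"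

definition cone_increasing :: "'a::real_vector set \<Rightarrow> ('a \<Rightarrow> ereal) \<Rightarrow> bool" where
  "cone_increasing K g \<longleftrightarrow> (\<forall>x y. y - x \<in> K \<longrightarrow> g x \<le> g y)"

lemma recession_cone_sublevel_mono:
  fixes g :: "'a::real_normed_vector \<Rightarrow> ereal"
  assumes "lsc_fun g" "proper_fun g" "convex_fun g"
    and ne: "sublevel g \<alpha> \<noteq> {}"
  shows "recession_cone (sublevel g \<alpha>) \<subseteq> recession_cone (sublevel g \<beta>)"
proof -
  obtain z where z: "g z \<le> ereal \<alpha>"
    using ne by (auto simp: sublevel_def)
  have decr: "g (y + t *\<^sub>R v) \<le> g y"
    if v: "v \<in> recession_cone (sublevel g \<alpha>)" and t: "t \<ge> 0" and y: "g y \<noteq> \<infinity>" for v y t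
  proof (rule ccontr)
    assume "\<not> g (y + t *\<^sub>R v) \<le> g y"
    define p where "p = y + t *\<^sub>R v"
    obtain r where r: "g y = ereal r"
      using y assms(2) by (cases "g y") (auto simp: proper_fun_def)
    have "g y < g p"
      using \<open>\<not> g (y + t *\<^sub>R v) \<le> g y\<close> by (simp add: p_def)
    then obtain c where c: "g y < ereal c" "ereal c < g p"
      using ereal_dense2 by blast
    have "eventually (\<lambda>u. ereal c < g u) (at p)"
      using assms(1) c(2) unfolding lsc_fun_def le_Liminf_iff by blast
    then have ev: "eventually (\<lambda>u. ereal c < g u) (nhds p)"
      unfolding eventually_at_filter
      by (rule eventually_mono) (use c(2) in auto)
    have "((\<lambda>s. p + s *\<^sub>R (z - y)) \<longlongrightarrow> p + 0 *\<^sub>R (z - y)) (at_right 0)"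
      by (intro tendsto_intros)
    then have 1: "eventually (\<lambda>s. ereal c < g (p + s *\<^sub>R (z - y))) (at_right 0)"
      using ev by (auto simp: filterlim_iff)
    have "((\<lambda>s. (1 - s) * r + s * \<alpha>) \<longlongrightarrow> (1 - 0) * r + 0 * \<alpha>) (at_right (0::real))"
      by (intro tendsto_intros)
    then have 2: "eventually (\<lambda>s. (1 - s) * r + s * \<alpha> < c) (at_right (0::real))"
      using c(1) r by (auto dest!: order_tendstoD(2)[where a = c])
    have 3: "eventually (\<lambda>s::real. s \<in> {0<..<1}) (at_right 0)"
      by (rule eventually_at_right_real) simp
    have "eventually (\<lambda>s::real. False) (at_right 0)"
      using 1 2 3
    proof eventually_elim
      case (elim s)
      have "g (z + (t / s) *\<^sub>R v) \<le> ereal \<alpha>"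
        using v t z elim by (auto simp: recession_cone_def sublevel_def)
      then have "ereal s * g (z + (t / s) *\<^sub>R v) \<le> ereal s * ereal \<alpha>"
        using elim by (intro ereal_mult_left_mono) auto
      moreover have "p + s *\<^sub>R (z - y) = (1 - s) *\<^sub>R y + s *\<^sub>R (z + (t / s) *\<^sub>R v)"
        using elim by (simp add: p_def algebra_simps)
      moreover have "g ((1 - s) *\<^sub>R y + s *\<^sub>R (z + (t / s) *\<^sub>R v))
          \<le> ereal (1 - s) * g y + ereal s * g (z + (t / s) *\<^sub>R v)"
        using assms(3) elim unfolding convex_fun_def by auto
      ultimately have "g (p + s *\<^sub>R (z - y)) \<le> ereal (1 - s) * g y + ereal s * ereal \<alpha>"
        by (metis add_left_mono order_trans)
      also have "\<dots> = ereal ((1 - s) * r + s * \<alpha>)"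
        by (simp add: r)
      also have "\<dots> < ereal c"
        using elim by simp
      finally show False
        using elim(1) by (meson less_asym)
    qed
    then show False
      by (simp add: trivial_limit_at_right_real)
  qed
  show ?thesis
  proof
    fix v assume v: "v \<in> recession_cone (sublevel g \<alpha>)"
    have "g (y + t *\<^sub>R v) \<le> ereal \<beta>" if "t \<ge> 0" "g y \<le> ereal \<beta>" for t y
      using decr[OF v that(1), of y] that(2) by (force intro: order_trans)
    then show "v \<in> recession_cone (sublevel g \<beta>)"
      by (auto simp: recession_cone_def sublevel_def)
  qed
qed

lemma hzn_eq_recession_cone:
  fixes g :: "'a::real_normed_vector \<Rightarrow> ereal"
  assumes "lsc_fun g" "proper_fun g" "convex_fun g" "sublevel g \<alpha> \<noteq> {}"
  shows "hzn g = recession_cone (sublevel g \<alpha>)"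
proof -
  have "sublevel g (SOME \<alpha>. sublevel g \<alpha> \<noteq> {}) \<noteq> {}"
    using assms(4) by (rule someI)
  then show ?thesis
    unfolding hzn_def using assms
    by (intro equalityI recession_cone_sublevel_mono)
qed

end

theory Submission
  imports Defs
begin

text \<open>Since \<open>hzn g\<close> does not depend on the level
  (\<open>hzn_eq_recession_cone\<close>), the level may be taken to be \<open>g y\<close> itself
  when this is finite: a step from \<open>y\<close> along a horizon direction then stays in that
  sublevel set.\<close>

theorem lemma19:
  fixes g :: "'a::real_inner \<Rightarrow> ereal"
  assumes "\<exists>B::'a set. finite B \<and> span B = UNIV"
    and "lsc_fun g" and "proper_fun g" and "convex_fun g"
  shows "cone_increasing (uminus ` hzn g) g"
  unfolding cone_increasing_def
proof (intro allI impI)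
  fix x y :: 'a
  assume "y - x \<in> uminus ` hzn g"
  then obtain w where w: "w \<in> hzn g" "y - x = - w"
    by blast
  \<comment> \<open>The factor 1 is the time \<open>t\<close> in
    \<open>recession_cone\<close>.\<close>
  then have x: "x = y + 1 *\<^sub>R w"
    by (simp add: algebra_simps)
  show "g x \<le> g y"
  proof (cases "g y")
    case (real r)
    then have y: "y \<in> sublevel g r"
      by (simp add: sublevel_def)
    then have "w \<in> recession_cone (sublevel g r)"
      using w(1) hzn_eq_recession_cone[OF assms(2-4)] by blast
    then have "x \<in> sublevel g r"
      unfolding x recession_cone_def using y zero_le_one by blast
    then show ?thesis
      by (simp add: sublevel_def real)
  \<comment> \<open>The value \<infinity> is a trivial bound; properness excludes
    -\<infinity>.\<close>
  qed (use assms(3) in \<open>auto simp: proper_fun_def\<close>)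
qed

end
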